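(* For each integer $N\ge 2$ let $\mathbf{X}=(X_1,\dots,X_{N-1})$ (depending on $N$) be a random vector with probability density $$ (N-1)!\,\frac{\prod_{1\le i<j\le N-1}(x_j-x_i)}{\prod_{1\le i<j\le N}(j^2-i^2)} $$ on the domain $\{1<x_1<2^2<x_2<3^2<\cdots<(N-1)^2<x_{N-1}<N^2\}$. Then $$ \frac1s\,\frac{1}{\Gamma_{N-1}\left(\frac s2\right)}\,\mathbb{E}\left[\prod_{n=1}^{N-1}\left(\frac{X_n}{n(n+1)}\right)^{s/2}\right]\longrightarrow \eta(s)\quad\text{as }N\to\infty, $$ uniformly for $s$ in every compact subset of $\mathbb{C}$.
   Context: $\eta$ is the Dirichlet eta (alternating zeta) function: the entire function which for $\Re(s)>0$ equals $\sum_{n\ge1}(-1)^{n-1}n^{-s}$. For $N>1$, $$\Gamma_{N-1}\left(\tfrac s2\right)=\frac2s\prod_{n=1}^{N-1}\frac{(1+\frac1n)^{s/2}}{1+\frac{s}{2n}},$$ and the factor $\frac{1}{s\Gamma_{N-1}(s/2)}$ is understood for all $s\in\mathbb{C}$ as the entire function $\frac12\prod_{n=1}^{N-1}\left(1+\frac{s}{2n}\right)\left(1+\frac1n\right)^{-s/2}$. The given density is the Dixon–Anderson density with all exponents $\alpha_i=1$ and nodes $a_n=n^2$, $1\le n\le N$. Complex powers of positive reals are defined with the real logarithm. *)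

theory Defs
  imports "HOL-Probability.Probability"
begin

text \<open>The sum below is only conditionally convergent for \<open>0 < Re s \<le> 1\<close>, so it is taken in its
  natural order. An entire function is determined by its values on a half-plane.\<close>

definition dirichlet_eta :: "complex \<Rightarrow> complex" where
  "dirichlet_eta =
     (THE f. f holomorphic_on UNIV \<and>
       (\<forall>s. Re s > 0 \<longrightarrow> (\<lambda>n. (-1) ^ n * of_nat (Suc n) powr (- s)) sums f s))"

definition Gamma_trunc :: "nat \<Rightarrow> complex \<Rightarrow> complex" where
  "Gamma_trunc m z = 1 / z * (\<Prod>n=1..m. (1 + 1 / of_nat n) powr z / (1 + z / of_nat n))"

text \<open>The entire function extending \<open>1 / (s * Gamma_trunc (N - 1) (s / 2))\<close>. Writing the quotient
  itself would give the wrong value at \<open>s = 0\<close>, because division by zero yields zero; see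
  \<open>inverse_s_Gamma_eq\<close> for the agreement at all other points.\<close>

definition inverse_s_Gamma :: "nat \<Rightarrow> complex \<Rightarrow> complex" where
  "inverse_s_Gamma N s =
     1 / 2 * (\<Prod>n=1..N-1. (1 + s / (2 * of_nat n)) * (1 + 1 / of_nat n) powr (- s / 2))"

lemma inverse_s_Gamma_eq:
  assumes "s \<noteq> 0"
  shows "inverse_s_Gamma N s = 1 / s * (1 / Gamma_trunc (N - 1) (s / 2))"
proof -
  have "(\<Prod>n=1..N-1. (1 + s / (2 * of_nat n)) * (1 + 1 / of_nat n) powr (- s / 2)) =
        inverse (\<Prod>n=1..N-1. (1 + 1 / of_nat n) powr (s / 2) / (1 + s / 2 / of_nat n))"
    unfolding prod_inversef[symmetric]
    by (intro prod.cong refl) (simp add: powr_minus field_simps)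
  then show ?thesis
    using assms by (simp add: inverse_s_Gamma_def Gamma_trunc_def field_simps)
qed

definition interlacing_domain :: "nat \<Rightarrow> (nat \<Rightarrow> real) set" where
  "interlacing_domain N = {x. \<forall>n\<in>{1..N-1}. (real n)\<^sup>2 < x n \<and> x n < (real n + 1)\<^sup>2}"

definition dixon_anderson_density :: "nat \<Rightarrow> (nat \<Rightarrow> real) \<Rightarrow> real" where
  "dixon_anderson_density N x =
     fact (N - 1) * (\<Prod>j=1..N-1. \<Prod>i\<in>{1..<j}. x j - x i)
       / (\<Prod>j=1..N. \<Prod>i\<in>{1..<j}. (real j)\<^sup>2 - (real i)\<^sup>2)
     * indicator (interlacing_domain N) x"

end

theory Submission
  imports Defs "HOL-Complex_Analysis.Complex_Analysis" "Jordan_Normal_Form.Determinant"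
begin

text \<open>
  The Vandermonde product in the density is a determinant, so the expectation is a determinant of
  one-dimensional integrals, and each of these is a difference of powers of consecutive integers.
  Such a determinant of row differences is the alternating sum of the minors obtained by omitting one
  node, and these minors are again Vandermonde determinants. All factors then cancel to give the
  exact identity
  \<open>\<Sum>j=1..N. (-1)^(j-1) * (2N choose (N-j)) / (2N choose N) * j powr (-s)\<close>
  for the quantity in question. Call this sum \<open>S N s\<close>. It satisfies
  \<open>S (N+1) s - S N s = S (N+1) (s-2) / (N+1)^2\<close>, and \<open>k\<close>-fold summation by parts against the
  binomial coefficients, with \<open>k\<close> large, shows that it is bounded locally uniformly in \<open>s\<close>.
  Hence it converges locally uniformly to an entire function, which is identified with the eta
  series for \<open>Re s > 0\<close> by one summation by parts and Tannery's theorem.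
\<close>

subsection \<open>Vandermonde determinants\<close>

lemma det_scale_rows:
  fixes c :: "nat \<Rightarrow> 'a::comm_ring_1"
  shows "det (mat n n (\<lambda>(i, l). c i * A i l)) = (\<Prod>i<n. c i) * det (mat n n (\<lambda>(i, l). A i l))"
proof -
  have "(\<Prod>i=0..<n. mat n n (\<lambda>(i, l). c i * A i l) $$ (i, p i)) =
      (\<Prod>i<n. c i) * (\<Prod>i=0..<n. mat n n (\<lambda>(i, l). A i l) $$ (i, p i))" if "p permutes {0..<n}" for p
    using permutes_in_image[OF that]
    by (simp add: prod.distrib[symmetric] atLeast0LessThan)
  then show ?thesis
    unfolding det_def'[OF mat_carrier] sum_distrib_left
    by (intro sum.cong) (auto simp: algebra_simps)
qed

text \<open>The coefficient matrix \<open>U\<close> of the Newton polynomials \<open>q l\<close> is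
  unitriangular and turns the Vandermonde matrix into the matrix of values
  \<open>poly (q l) (a i)\<close>. The latter is lower triangular because \<open>q l\<close>
  vanishes at \<open>a i\<close> for \<open>i < l\<close>.\<close>

lemma det_vandermonde:
  fixes a :: "nat \<Rightarrow> 'a::idom"
  shows "det (mat n n (\<lambda>(i, l). a i ^ l)) = (\<Prod>i<n. \<Prod>m<i. a i - a m)"
proof -
  define q where "q l = (\<Prod>m<l. [:- a m, 1:])" for l
  define V U where "V = mat n n (\<lambda>(i, l). a i ^ l)" and "U = mat n n (\<lambda>(k, l). coeff (q l) k)"
  have carr: "V \<in> carrier_mat n n" "U \<in> carrier_mat n n" by (simp_all add: V_def U_def)
  have deg: "degree (q l) = l" for l
    unfolding q_def by (subst degree_prod_eq_sum_degree) auto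
  have lc: "coeff (q l) l = 1" for l
    using lead_coeff_prod[of "\<lambda>m. [:- a m, 1:]" "{..<l}"] deg[of l] by (simp add: q_def)
  have VU: "V * U = mat n n (\<lambda>(i, l). poly (q l) (a i))"
  proof (rule eq_matI, goal_cases)
    case (1 i l)
    then have "poly (q l) (a i) = (\<Sum>k<n. coeff (q l) k * a i ^ k)"
      unfolding poly_altdef deg
      by (intro sum.mono_neutral_left) (auto simp: coeff_eq_0 deg)
    with 1 show ?case
      by (simp add: V_def U_def scalar_prod_def atLeast0LessThan mult.commute)
  qed (simp_all add: V_def U_def)
  have pq: "poly (q l) x = (\<Prod>m<l. x - a m)" for l x
    by (simp add: q_def poly_prod)
  have "det U = 1"
    by (subst det_upper_triangular[OF _ carr(2)])
       (auto simp: U_def prod_list_diag_prod lc coeff_eq_0 deg)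
  moreover have "det (V * U) = (\<Prod>i<n. \<Prod>m<i. a i - a m)"
    unfolding VU
    by (subst det_lower_triangular[OF _ mat_carrier])
       (auto simp: prod_list_diag_prod pq atLeast0LessThan)
  ultimately show ?thesis
    using det_mult[OF carr] by (simp add: V_def)
qed

text \<open>After bordering, both sides are expansions of \<open>det P\<close>. Since
  \<open>P = L * D\<close> with \<open>L\<close> the summation matrix, of determinant 1, one may
  expand along the first column of \<open>D\<close>, where only the corner survives, or along that
  of \<open>P\<close>, where every entry is 1.\<close>

lemma det_row_differences:
  fixes F :: "nat \<Rightarrow> nat \<Rightarrow> 'a::comm_ring_1"
  shows "det (mat n n (\<lambda>(i, l). F (Suc i) l - F i l)) =
    (\<Sum>j\<le>n. (-1) ^ j * det (mat n n (\<lambda>(i, l). F (if i < j then i else Suc i) l)))"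
proof -
  define P where "P = mat (Suc n) (Suc n) (\<lambda>(i, l). if l = 0 then 1 else F i (l - 1))"
  define D where "D = mat (Suc n) (Suc n) (\<lambda>(i, l). if i = 0 then if l = 0 then 1 else F 0 (l - 1)
    else if l = 0 then 0 else F i (l - 1) - F (i - 1) (l - 1))"
  define L where "L = mat (Suc n) (Suc n) (\<lambda>(i, k). if k \<le> i then 1 else (0::'a))"
  have carr: "P \<in> carrier_mat (Suc n) (Suc n)" "D \<in> carrier_mat (Suc n) (Suc n)"
    "L \<in> carrier_mat (Suc n) (Suc n)"
    by (simp_all add: P_def D_def L_def)
  have LD: "P = L * D"
  proof (rule eq_matI, goal_cases)
    case (1 i l)
    then have il: "i < Suc n" "l < Suc n" by (simp_all add: L_def D_def)
    have "(L * D) $$ (i, l) = (\<Sum>k<Suc n. (if k \<le> i then 1 else 0) * D $$ (k, l))"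
      using il carr by (simp add: L_def scalar_prod_def atLeast0LessThan del: sum.lessThan_Suc)
    also have "\<dots> = (\<Sum>k\<le>i. D $$ (k, l))"
      using il by (intro sum.mono_neutral_cong_right) auto
    also have "\<dots> = P $$ (i, l)"
    proof -
      have "i < Suc n \<Longrightarrow> (\<Sum>k\<le>i. D $$ (k, l)) = P $$ (i, l)"
        using il(2) by (induction i) (auto simp: D_def P_def)
      with il show ?thesis by simp
    qed
    finally show ?case by simp
  qed (simp_all add: P_def L_def D_def)
  have "det L = 1"
    by (subst det_lower_triangular[OF _ carr(3)]) (auto simp: L_def prod_list_diag_prod)
  then have "det P = det D"
    using det_mult[OF carr(3,2)] LD by simp
  also have "\<dots> = (\<Sum>i<Suc n. D $$ (i, 0) * cofactor D i 0)"
    by (rule laplace_expansion_column[OF carr(2)]) simp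
  also have "\<dots> = (\<Sum>i\<in>{0}. D $$ (i, 0) * cofactor D i 0)"
    by (intro sum.mono_neutral_right) (auto simp: D_def)
  also have "\<dots> = det (mat_delete D 0 0)"
    by (simp add: D_def cofactor_def)
  also have "mat_delete D 0 0 = mat n n (\<lambda>(i, l). F (Suc i) l - F i l)"
    by (auto simp: mat_delete_def D_def intro!: eq_matI)
  finally have "det (mat n n (\<lambda>(i, l). F (Suc i) l - F i l)) = det P" ..
  also have "\<dots> = (\<Sum>j<Suc n. P $$ (j, 0) * cofactor P j 0)"
    by (rule laplace_expansion_column[OF carr(1)]) simp
  also have "\<dots> = (\<Sum>j\<le>n. (-1) ^ j * det (mat n n (\<lambda>(i, l). F (if i < j then i else Suc i) l)))"
    unfolding lessThan_Suc_atMost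
  proof (rule sum.cong[OF refl])
    fix j assume "j \<in> {..n}"
    then have "mat_delete P j 0 = mat n n (\<lambda>(i, l). F (if i < j then i else Suc i) l)"
      by (auto simp: mat_delete_def P_def intro!: eq_matI)
    with \<open>j \<in> {..n}\<close> show "P $$ (j, 0) * cofactor P j 0 =
        (-1) ^ j * det (mat n n (\<lambda>(i, l). F (if i < j then i else Suc i) l))"
      by (simp add: P_def cofactor_def)
  qed
  finally show ?thesis .
qed

text \<open>Supplies the quotient of the full Vandermonde product by a minor. The induction starts
  at \<open>n = j\<close>, where the removed node is the last one; each further node contributes its
  difference to \<open>a j\<close> and otherwise the same factors on both sides.\<close>

lemma vandermonde_remove_node:
  fixes a :: "nat \<Rightarrow> 'a::comm_ring_1"
  assumes "j \<le> n"
  shows "(\<Prod>i<Suc n. \<Prod>m<i. a i - a m) =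
    (\<Prod>i<n. \<Prod>m<i. a (if i < j then i else Suc i) - a (if m < j then m else Suc m)) *
    ((\<Prod>m<j. a j - a m) * (\<Prod>i\<in>{j<..n}. a i - a j))"
  using assms
proof (induction n rule: dec_induct)
  case base
  have "(\<Prod>i<j. \<Prod>m<i. a (if i < j then i else Suc i) - a (if m < j then m else Suc m)) =
      (\<Prod>i<j. \<Prod>m<i. a i - a m)"
    by (intro prod.cong) auto
  then show ?case by simp
next
  case (step n)
  let ?b = "\<lambda>i. a (if i < j then i else Suc i)"
  have factor: "(\<Prod>m<Suc n. a (Suc n) - a m) = (a (Suc n) - a j) * (\<Prod>m<n. ?b n - ?b m)"
  proof -
    have "(\<Prod>m<Suc n. a (Suc n) - a m) = (a (Suc n) - a j) * (\<Prod>m\<in>{..<Suc n} - {j}. a (Suc n) - a m)"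
      using step by (subst prod.remove[of _ j]) auto
    also have "(\<Prod>m\<in>{..<Suc n} - {j}. a (Suc n) - a m) = (\<Prod>m<n. a (Suc n) - ?b m)"
      using step
      by (intro prod.reindex_bij_witness[of _ "\<lambda>m. if m < j then m else Suc m"
            "\<lambda>m. if m < j then m else m - 1"]) (auto split: if_splits)
    also have "\<dots> = (\<Prod>m<n. ?b n - ?b m)"
      using step by simp
    finally show ?thesis .
  qed
  have "{j<..Suc n} = insert (Suc n) {j<..n}"
    using step by auto
  then show ?case
    using step.IH by (subst prod.lessThan_Suc) (simp add: factor del: prod.lessThan_Suc, simp add: mult_ac)
qed

text \<open>Each difference of squares splits into a difference and a sum of integers, so two
  factorial-like products appear. The extra factor consists of \<open>2 * (j + 1)\<close>, the sum
  missing at \<open>m = j\<close>, and \<open>j + 1\<close>, the quotient of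
  \<open>fact (j + 1)\<close> by \<open>fact j\<close>.\<close>

lemma prod_square_differences:
  assumes "j \<le> n"
  shows "(\<Prod>m<j. (real j + 1)\<^sup>2 - (real m + 1)\<^sup>2) * (\<Prod>i\<in>{j<..n}. (real i + 1)\<^sup>2 - (real j + 1)\<^sup>2)
     * (2 * (real j + 1)\<^sup>2) = fact (n - j) * fact (n + j + 2)"
  using assms
proof (induction n rule: dec_induct)
  case base
  have 1: "(\<Prod>m<j. real j - real m) = fact j"
  proof -
    have "(\<Prod>m<j. real j - real m) = (\<Prod>m<j. real (Suc m))"
      by (rule prod.reindex_bij_witness[of _ "\<lambda>m. j - 1 - m" "\<lambda>m. j - 1 - m"]) auto
    then show ?thesis by (simp add: fact_prod_Suc atLeast0LessThan)
  qed
  have 2: "(\<Prod>m<k. real j + real m + 2) * fact (j + 1) = fact (j + k + 1)" for k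
    by (induction k) (simp_all add: algebra_simps)
  have "(\<Prod>m<j. (real j + 1)\<^sup>2 - (real m + 1)\<^sup>2) = (\<Prod>m<j. real j - real m) * (\<Prod>m<j. real j + real m + 2)"
    unfolding prod.distrib[symmetric]
    by (intro prod.cong) (auto simp: power2_eq_square algebra_simps)
  then have "(\<Prod>m<j. (real j + 1)\<^sup>2 - (real m + 1)\<^sup>2) * (2 * (real j + 1)\<^sup>2) =
      2 * (real j + 1) * ((\<Prod>m<j. real j + real m + 2) * fact (j + 1))"
    by (simp only: 1) (simp add: power2_eq_square, simp add: algebra_simps)
  also have "\<dots> = fact (j + j + 2)"
    unfolding 2 by (simp add: algebra_simps)
  finally show ?case by simp
next
  case (step n)
  let ?P = "\<Prod>m<j. (real j + 1)\<^sup>2 - (real m + 1)\<^sup>2"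
  let ?Q = "\<lambda>n. \<Prod>i\<in>{j<..n}. (real i + 1)\<^sup>2 - (real j + 1)\<^sup>2"
  let ?c = "2 * (real j + 1)\<^sup>2"
  have "{j<..Suc n} = insert (Suc n) {j<..n}"
    using step by auto
  then have "?Q (Suc n) = ((real (Suc n) + 1)\<^sup>2 - (real j + 1)\<^sup>2) * ?Q n"
    by simp
  also have "(real (Suc n) + 1)\<^sup>2 - (real j + 1)\<^sup>2 = real (Suc (n - j)) * real (Suc (n + j + 2))"
    using step by (simp add: of_nat_diff power2_eq_square algebra_simps)
  finally have "?P * ?Q (Suc n) * ?c = (real (Suc (n - j)) * real (Suc (n + j + 2))) * (?P * ?Q n * ?c)"
    by (simp only: mult_ac)
  also have "\<dots> = fact (Suc (n - j)) * fact (Suc (n + j + 2))"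
    unfolding step.IH fact_Suc by (simp only: mult_ac)
  also have "Suc (n - j) = Suc n - j"
    using step by simp
  also have "Suc (n + j + 2) = Suc n + j + 2"
    by simp
  finally show ?case .
qed

subsection \<open>Convergence of the binomially weighted sums\<close>

text \<open>This is \<open>S N s\<close> of the overview, with the index shifted down by one. For
  fixed \<open>j\<close> the binomial weight tends to 1 as \<open>N\<close> grows, so the terms tend
  to those of the eta series.\<close>

definition eta_approx :: "nat \<Rightarrow> complex \<Rightarrow> complex" where
  "eta_approx N s = (\<Sum>j<N. (-1) ^ j * of_real (real (2 * N choose (N - Suc j)) / real (2 * N choose N))
     * of_nat (Suc j) powr (- s))"

section \<open>Repeated summation by parts against binomial coefficients\<close>

definition back_diff :: "(nat \<Rightarrow> 'a::ab_group_add) \<Rightarrow> nat \<Rightarrow> 'a" where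
  "back_diff h m = h m - (case m of 0 \<Rightarrow> 0 | Suc k \<Rightarrow> h k)"

lemma back_diff_simps [simp]:
  "back_diff h 0 = h 0" "back_diff h (Suc m) = h (Suc m) - h m"
  by (simp_all add: back_diff_def)

text \<open>Pascal's rule splits every coefficient in two, and shifting the index in one part flips
  its sign. Because \<open>back_diff\<close> takes the value before index 0 to be 0, no boundary
  term is left.\<close>

lemma alternating_binomial_sum_by_parts:
  fixes h :: "nat \<Rightarrow> 'a::comm_ring_1"
  shows "(\<Sum>m\<le>N. (-1) ^ m * of_nat (Suc n choose (N - m)) * h m) =
    (\<Sum>m\<le>N. (-1) ^ m * of_nat (n choose (N - m)) * back_diff h m)"
proof (cases N)
  case (Suc M)
  have "(\<Sum>m\<le>Suc M. (-1) ^ m * of_nat (Suc n choose (Suc M - m)) * h m) =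
      (\<Sum>m\<le>M. (-1) ^ m * of_nat (n choose (Suc M - m)) * h m) + (-1) ^ Suc M * h (Suc M) +
      (\<Sum>m\<le>M. (-1) ^ m * of_nat (n choose (M - m)) * h m)"
    by (simp add: Suc_diff_le algebra_simps sum.distrib)
  also have "\<dots> = (\<Sum>m\<le>Suc M. (-1) ^ m * of_nat (n choose (Suc M - m)) * h m) +
      (\<Sum>m\<le>M. (-1) ^ m * of_nat (n choose (M - m)) * h m)"
    by simp
  also have "\<dots> = (\<Sum>m\<le>Suc M. (-1) ^ m * of_nat (n choose (Suc M - m)) * back_diff h m)"
    unfolding sum.atMost_Suc_shift[of _ M]
    by (simp add: algebra_simps sum.distrib sum_negf sum_subtractf)
  finally show ?thesis by (simp add: Suc)
qed simp

lemma alternating_binomial_sum_iterate: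
  fixes h :: "nat \<Rightarrow> 'a::comm_ring_1"
  shows "(\<Sum>m\<le>N. (-1) ^ m * of_nat ((n + k) choose (N - m)) * h m) =
    (\<Sum>m\<le>N. (-1) ^ m * of_nat (n choose (N - m)) * (back_diff ^^ k) h m)"
proof (induction k arbitrary: h)
  case (Suc k)
  show ?case
    using alternating_binomial_sum_by_parts[where N = N and n = "n + k" and h = h] Suc.IH[of "back_diff h"]
    by (simp add: funpow_swap1)
qed simp

lemma eta_approx_back_diff:
  assumes "k \<le> 2 * N"
  shows "eta_approx N s = - (\<Sum>m\<le>N. (-1) ^ m *
    of_real (real ((2 * N - k) choose (N - m)) / real (2 * N choose N)) *
    (back_diff ^^ k) (\<lambda>m. of_nat m powr (- s)) m)"
proof -
  let ?h = "\<lambda>m. of_nat m powr (- s)" and ?c = "of_nat (2 * N choose N) :: complex"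
  \<comment> \<open>As \<open>0 powr (- s) = 0\<close>, the sum may start at \<open>m = 0\<close>;
    the shift \<open>m = Suc j\<close> produces the minus sign.\<close>
  have "?c * eta_approx N s = - (\<Sum>m\<le>N. (-1) ^ m * of_nat (2 * N choose (N - m)) * ?h m)"
    unfolding lessThan_Suc_atMost[symmetric] sum.lessThan_Suc_shift
    by (simp add: eta_approx_def sum_distrib_left sum_negf flip: of_nat_Suc)
  also have "\<dots> = - (\<Sum>m\<le>N. (-1) ^ m * of_nat ((2 * N - k) choose (N - m)) * (back_diff ^^ k) ?h m)"
    using alternating_binomial_sum_iterate[where N = N and n = "2 * N - k" and k = k and h = ?h] assms by simp
  also have "\<dots> = ?c * - (\<Sum>m\<le>N. (-1) ^ m *
      of_real (real ((2 * N - k) choose (N - m)) / real (2 * N choose N)) * (back_diff ^^ k) ?h m)"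
    by (simp add: sum_distrib_left sum_negf)
  finally have eq: "?c * eta_approx N s = ?c * - (\<Sum>m\<le>N. (-1) ^ m *
      of_real (real ((2 * N - k) choose (N - m)) / real (2 * N choose N)) * (back_diff ^^ k) ?h m)" .
  have "?c \<noteq> 0" by simp
  then show ?thesis
    using eq by (rule mult_left_cancel[THEN iffD1])
qed

section \<open>Size of the iterated differences of complex powers\<close>

primrec power_diff :: "nat \<Rightarrow> complex \<Rightarrow> real \<Rightarrow> complex" where
  "power_diff 0 s x = of_real x powr (- s)"
| "power_diff (Suc k) s x = power_diff k s x - power_diff k s (x - 1)"

text \<open>Passing to a real variable makes the mean value inequality available. For
  \<open>m < k\<close> the zero convention of \<open>back_diff\<close> would enter, hence the
  restriction.\<close>

lemma back_diff_eq_power_diff: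
  assumes "k \<le> m"
  shows "(back_diff ^^ k) (\<lambda>m. of_nat m powr (- s)) m = power_diff k s (real m)"
  using assms
proof (induction k arbitrary: m)
  case (Suc k)
  then obtain l where "m = Suc l" by (cases m) auto
  with Suc show ?case by simp
qed simp

text \<open>Differentiation commutes with taking differences; \<open>real k < x\<close> keeps all
  shifted arguments positive.\<close>

lemma power_diff_has_vector_derivative:
  assumes "real k < x"
  shows "(power_diff k s has_vector_derivative - s * power_diff k (s + 1) x) (at x)"
  using assms
proof (induction k arbitrary: x)
  case 0
  then have "((\<lambda>z. z powr (- s)) has_field_derivative (- s * of_real x powr (- s - 1))) (at (of_real x))"
    by (intro has_field_derivative_powr) (auto simp: complex_nonpos_Reals_iff)
  from has_vector_derivative_real_field[OF this] show ?case
    by (simp add: power_diff.simps(1)[abs_def])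
next
  case (Suc k)
  have "((\<lambda>x. x - 1) has_vector_derivative 1) (at x)"
    by (auto intro!: derivative_eq_intros)
  moreover have "(power_diff k s has_vector_derivative - s * power_diff k (s + 1) (x - 1)) (at (x - 1))"
    using Suc.prems by (intro Suc.IH) auto
  ultimately have "((\<lambda>x. power_diff k s (x - 1)) has_vector_derivative
      - s * power_diff k (s + 1) (x - 1)) (at x)"
    using vector_diff_chain_at[of "\<lambda>x. x - 1" 1 x "power_diff k s"] by (simp add: o_def)
  moreover have "(power_diff k s has_vector_derivative - s * power_diff k (s + 1) x) (at x)"
    using Suc.prems by (intro Suc.IH) auto
  ultimately have "((\<lambda>x. power_diff k s x - power_diff k s (x - 1)) has_vector_derivative
      - s * power_diff k (s + 1) x - - s * power_diff k (s + 1) (x - 1)) (at x)"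
    by (intro has_vector_derivative_diff)
  then show ?case
    by (simp add: power_diff.simps(2)[abs_def] algebra_simps)
qed

text \<open>Each difference is bounded by the mean value inequality: the derivative contributes
  \<open>norm s\<close> and moves \<open>s\<close> to \<open>s + 1\<close>. The sign condition makes
  the power nonincreasing, so on \<open>{x - 1..x}\<close> it is bounded by its value at the left
  end.\<close>

lemma norm_power_diff_le:
  assumes "0 \<le> Re s + k" "real k < x"
  shows "norm (power_diff k s x) \<le> (\<Prod>i<k. norm (s + of_nat i)) * (x - k) powr - (Re s + k)"
  using assms
proof (induction k arbitrary: s x)
  case 0
  then show ?case by (simp add: norm_powr_real_powr)
next
  case (Suc k)
  define B where "B = (\<Prod>i<Suc k. norm (s + of_nat i)) * (x - Suc k) powr - (Re s + Suc k)"
  have "norm (power_diff k s x - power_diff k s (x - 1)) \<le> B * norm (x - (x - 1))"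
  proof (rule differentiable_bound)
    fix y assume y: "y \<in> {x - 1..x}"
    then have "real k < y" using Suc.prems by auto
    then show "(power_diff k s has_derivative (\<lambda>h. h *\<^sub>R (- s * power_diff k (s + 1) y))) (at y within {x - 1..x})"
      using power_diff_has_vector_derivative[of k y s]
      by (auto simp: has_vector_derivative_def intro: has_derivative_at_withinI)
    have "norm (power_diff k (s + 1) y) \<le>
        (\<Prod>i<k. norm (s + 1 + of_nat i)) * (y - k) powr - (Re (s + 1) + k)"
      using Suc.prems \<open>real k < y\<close> by (intro Suc.IH) auto
    also have "\<dots> \<le> (\<Prod>i<k. norm (s + 1 + of_nat i)) * (x - Suc k) powr - (Re s + Suc k)"
      using Suc.prems y by (intro mult_left_mono prod_nonneg) (auto intro!: powr_mono2' simp: algebra_simps)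
    finally have "norm s * norm (power_diff k (s + 1) y) \<le>
        norm s * ((\<Prod>i<k. norm (s + 1 + of_nat i)) * (x - Suc k) powr - (Re s + Suc k))"
      by (intro mult_left_mono) auto
    also have "\<dots> = B"
      unfolding B_def prod.lessThan_Suc_shift by (simp add: algebra_simps)
    finally have "norm (- s * power_diff k (s + 1) y) \<le> B"
      by (simp add: norm_mult)
    moreover have "onorm (\<lambda>h. h *\<^sub>R (- s * power_diff k (s + 1) y)) \<le> norm (- s * power_diff k (s + 1) y)"
      by (rule onorm_le) (simp add: mult.commute)
    ultimately show "onorm (\<lambda>h. h *\<^sub>R (- s * power_diff k (s + 1) y)) \<le> B"
      by linarith
  qed auto
  then show ?case by (simp add: B_def)
qed

text \<open>A crude bound for the initial indices, which \<open>norm_power_diff_le\<close> does not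
  reach.\<close>

lemma norm_back_diff_le:
  fixes h :: "nat \<Rightarrow> 'a::real_normed_vector"
  assumes "\<And>i. i \<le> m \<Longrightarrow> norm (h i) \<le> B"
  shows "norm ((back_diff ^^ k) h m) \<le> 2 ^ k * B"
  using assms
proof (induction k arbitrary: m)
  case (Suc k)
  have "0 \<le> B" using Suc.prems[of 0] norm_ge_zero[of "h 0"] by linarith
  show ?case
  proof (cases m)
    case 0
    then have "norm ((back_diff ^^ k) h 0) \<le> 2 ^ k * B" using Suc by auto
    also have "\<dots> \<le> 2 ^ Suc k * B" using \<open>0 \<le> B\<close> by simp
    finally show ?thesis by (simp add: 0)
  next
    case (Suc l)
    then have "norm ((back_diff ^^ k) h m) \<le> 2 ^ k * B" "norm ((back_diff ^^ k) h l) \<le> 2 ^ k * B"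
      using Suc.prems by (auto intro!: Suc.IH)
    then show ?thesis
      using norm_triangle_ineq4[of "(back_diff ^^ k) h m" "(back_diff ^^ k) h l"] Suc by simp
  qed
qed simp

text \<open>The central coefficient is the largest of its row, and lowering the upper index does not
  increase a coefficient. So the weights are at most 1 whatever \<open>k\<close> is.\<close>

lemma norm_binomial_ratio_mult_le:
  fixes z :: complex
  shows "norm ((-1) ^ m * of_real (real ((2 * N - k) choose i) / real (2 * N choose N)) * z) \<le> norm z"
proof -
  have "(2 * N - k) choose i \<le> 2 * N choose N"
    using binomial_right_mono[of "2 * N - k" "2 * N" i] binomial_maximum'[of N i] by linarith
  then have "real ((2 * N - k) choose i) / real (2 * N choose N) \<le> 1"
    by (simp add: divide_le_eq_1)
  then show ?thesis
    unfolding norm_mult norm_power norm_of_real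
    by (intro mult_left_le_one_le) (simp_all del: of_nat_eq_0_iff)
qed

lemma norm_eta_approx_le:
  assumes "k \<le> 2 * N"
  shows "norm (eta_approx N s) \<le> (\<Sum>m\<le>N. norm ((back_diff ^^ k) (\<lambda>m. of_nat m powr (- s)) m))"
  unfolding eta_approx_back_diff[OF assms] norm_minus_cancel
  by (intro sum_norm_le norm_binomial_ratio_mult_le)

text \<open>For \<open>k\<close> large, the \<open>k\<close>-th differences of \<open>m powr (- s)\<close> are absolutely summable, whatever the
  size of \<open>Re s\<close>.\<close>

lemma eta_approx_bounded:
  fixes R :: real
  shows "\<exists>C. \<forall>\<^sub>F N in sequentially. \<forall>s. norm s \<le> R \<longrightarrow> norm (eta_approx N s) \<le> C"
proof (cases "R \<ge> 0")
  case False
  then have "\<not> norm s \<le> R" for s :: complex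
    using norm_ge_zero[of s] by linarith
  then show ?thesis by simp
next
  case True
  \<comment> \<open>With \<open>R + 2 \<le> k\<close> the exponent \<open>Re s + k\<close> is at
    least 2 for all \<open>s\<close> in the disc, which makes the differences decay like
    \<open>(m - k) powr (-2)\<close>.\<close>
  define k where "k = nat \<lceil>R\<rceil> + 2"
  have k: "R + 2 \<le> real k"
    unfolding k_def using True by (simp add: real_nat_ceiling_ge)
  \<comment> \<open>The finitely many indices \<open>m \<le> k\<close> get the crude bound, all
    others the bound from the mean value inequality.\<close>
  define g where "g m = (if m \<le> k then 2 ^ k * (real k powr R)
    else (\<Prod>i<k. R + real i) * real (m - k) powr (-2))" for m
  have "summable g"
  proof -
    have "summable (\<lambda>m. (\<Prod>i<k. R + real i) * real m powr (-2))"
      by (intro summable_mult) (simp add: summable_real_powr_iff)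
    moreover have "(\<lambda>m. g (m + Suc k)) = (\<lambda>m. (\<Prod>i<k. R + real i) * real (Suc m) powr (-2))"
      by (auto simp: g_def)
    ultimately have "summable (\<lambda>m. g (m + Suc k))"
      by (simp only: summable_Suc_iff[of "\<lambda>m. (\<Prod>i<k. R + real i) * real m powr (-2)"])
    then show ?thesis by (simp only: summable_iff_shift)
  qed
  have nonneg: "g m \<ge> 0" for m
    using True by (auto simp: g_def intro!: mult_nonneg_nonneg prod_nonneg)
  have bound: "norm ((back_diff ^^ k) (\<lambda>m. of_nat m powr (- s)) m) \<le> g m" if s: "norm s \<le> R" for s :: complex and m
  proof -
    have Re: "\<bar>Re s\<bar> \<le> R" using abs_Re_le_cmod[of s] s by linarith
    show ?thesis
    proof (cases "m \<le> k")
      case m: True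
      have "norm (of_nat i powr (- s)) \<le> real k powr R" if "i \<le> m" for i
      proof (cases "i = 0")
        case False
        have "norm (of_nat i powr (- s)) = real i powr (- Re s)"
          by (simp add: norm_powr_real_powr)
        also have "\<dots> \<le> real i powr R"
          using False Re by (intro powr_mono) auto
        also have "\<dots> \<le> real k powr R"
          using that m True by (intro powr_mono2) auto
        finally show ?thesis .
      qed simp
      from norm_back_diff_le[OF this, where k = k] m show ?thesis by (simp add: g_def)
    next
      case m: False
      then have "norm ((back_diff ^^ k) (\<lambda>m. of_nat m powr (- s)) m) \<le>
          (\<Prod>i<k. norm (s + of_nat i)) * (real m - real k) powr - (Re s + real k)"
        using norm_power_diff_le[of s k "real m"] back_diff_eq_power_diff[of k m s] Re k by simp
      also have "\<dots> \<le> (\<Prod>i<k. R + real i) * (real m - real k) powr (-2)"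
      proof (intro mult_mono prod_mono conjI)
        show "norm (s + of_nat i) \<le> R + real i" for i
          using norm_triangle_ineq[of s "of_nat i"] s by simp
        show "(real m - real k) powr - (Re s + real k) \<le> (real m - real k) powr - 2"
          using m k Re by (intro powr_mono) auto
      qed (use True in \<open>auto intro!: prod_nonneg\<close>)
      finally show ?thesis using m by (simp add: g_def of_nat_diff)
    qed
  qed
  have "norm (eta_approx N s) \<le> suminf g" if "N \<ge> k" "norm s \<le> R" for N s
  proof -
    have "norm (eta_approx N s) \<le> (\<Sum>m\<le>N. norm ((back_diff ^^ k) (\<lambda>m. of_nat m powr (- s)) m))"
      using that by (intro norm_eta_approx_le) auto
    also have "\<dots> \<le> (\<Sum>m\<le>N. g m)"
      using bound[OF that(2)] by (intro sum_mono)
    also have "\<dots> \<le> suminf g"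
      using \<open>summable g\<close> nonneg by (intro sum_le_suminf) auto
    finally show ?thesis .
  qed
  then show ?thesis
    by (intro exI[of _ "suminf g"] eventually_mono[OF eventually_ge_at_top[of k]]) auto
qed

section \<open>Recurrence in \<open>N\<close> and locally uniform convergence\<close>

lemma central_binomial_ratio:
  assumes "i \<le> N"
  shows "real (2 * N choose (N - i)) / real (2 * N choose N) = (fact N)\<^sup>2 / (fact (N - i) * fact (N + i))"
  using assms by (simp add: binomial_fact power2_eq_square mult_2)

text \<open>Consecutive weights differ by a multiple of the square of \<open>i\<close>. Absorbing
  this square into the power of \<open>i\<close> is what shifts \<open>s\<close> by 2 in
  \<open>eta_approx_Suc_diff\<close>.\<close>

lemma binomial_ratio_Suc:
  assumes "0 < i" "i \<le> N"
  shows "real (2 * N choose (N - i)) / real (2 * N choose N) =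
    (1 - (real i / real (Suc N))\<^sup>2) * (real (2 * Suc N choose (Suc N - i)) / real (2 * Suc N choose Suc N))"
proof -
  have 1: "fact (Suc N - i) = (real (Suc N) - real i) * fact (N - i)"
    using assms by (simp add: Suc_diff_le of_nat_diff)
  have 2: "fact (Suc N + i) = (real (Suc N) + real i) * fact (N + i)" by simp
  have 3: "real (Suc N) - real i \<noteq> 0" "real (Suc N) + real i \<noteq> 0"
    using assms by auto
  have 4: "1 - (real i / real (Suc N))\<^sup>2 = (real (Suc N) - real i) * (real (Suc N) + real i) / (real (Suc N))\<^sup>2"
    by (simp add: field_simps power2_eq_square del: of_nat_Suc)
  show ?thesis
    unfolding central_binomial_ratio[OF assms(2)] central_binomial_ratio[OF le_SucI[OF assms(2)]] 1 2 4 fact_Suc[of N]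
    using 3 by (simp add: power_mult_distrib del: of_nat_Suc)
qed

lemma eta_approx_Suc_diff:
  "eta_approx (Suc N) s - eta_approx N s = eta_approx (Suc N) (s - 2) / (of_nat (Suc N))\<^sup>2"
proof -
  define c where "c j = complex_of_real (real (2 * Suc N choose (Suc N - Suc j)) / real (2 * Suc N choose Suc N))" for j
  have "eta_approx N s = (\<Sum>j<N. (1 - (of_nat (Suc j) / of_nat (Suc N))\<^sup>2) * ((-1) ^ j * c j * of_nat (Suc j) powr (- s)))"
    unfolding eta_approx_def
    by (intro sum.cong refl) (subst binomial_ratio_Suc, auto simp: c_def simp del: of_nat_Suc mult_Suc_right binomial_Suc_Suc)
  \<comment> \<open>The added term \<open>j = N\<close> is zero because its first factor
    vanishes.\<close>
  also have "\<dots> = (\<Sum>j<Suc N. (1 - (of_nat (Suc j) / of_nat (Suc N))\<^sup>2) * ((-1) ^ j * c j * of_nat (Suc j) powr (- s)))"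
    by (simp del: of_nat_Suc)
  also have "\<dots> = eta_approx (Suc N) s -
      (\<Sum>j<Suc N. ((-1) ^ j * c j * ((of_nat (Suc j))\<^sup>2 * of_nat (Suc j) powr (- s)))) / (of_nat (Suc N))\<^sup>2"
    unfolding eta_approx_def c_def[symmetric] sum_divide_distrib sum_subtractf[symmetric]
    by (intro sum.cong refl) (simp add: field_simps del: of_nat_Suc)
  finally have "eta_approx (Suc N) s - eta_approx N s =
      (\<Sum>j<Suc N. ((-1) ^ j * c j * ((of_nat (Suc j))\<^sup>2 * of_nat (Suc j) powr (- s)))) / (of_nat (Suc N))\<^sup>2"
    by simp
  moreover have "(of_nat (Suc j))\<^sup>2 * of_nat (Suc j) powr (- s) = (of_nat (Suc j) :: complex) powr (- (s - 2))" for j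
    by (simp add: powr_diff powr_minus field_simps del: of_nat_Suc)
  ultimately show ?thesis
    unfolding eta_approx_def[of _ "s - 2"] c_def by simp
qed

text \<open>A series of increments instead of a limit, so that the Weierstrass test applies
  directly. It telescopes without an initial term, since \<open>eta_approx 0 s = 0\<close>.\<close>

definition eta_limit :: "complex \<Rightarrow> complex" where
  "eta_limit s = (\<Sum>i. eta_approx (Suc i) s - eta_approx i s)"

text \<open>By the recurrence, the increments are of order \<open>1 / N^2\<close> once the sums are
  bounded at \<open>s - 2\<close>. This is why the bound is taken on the disc of radius
  \<open>R + 2\<close>.\<close>

lemma uniform_limit_eta_approx_cball:
  "uniform_limit (cball 0 R) eta_approx eta_limit sequentially"
proof -
  obtain C where "\<forall>\<^sub>F N in sequentially. \<forall>s. norm s \<le> R + 2 \<longrightarrow> norm (eta_approx N s) \<le> C"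
    using eta_approx_bounded by blast
  then have "\<forall>\<^sub>F N in sequentially. \<forall>s. norm s \<le> R + 2 \<longrightarrow> norm (eta_approx (Suc N) s) \<le> C"
    by (rule eventually_compose_filterlim) (rule filterlim_Suc)
  then have "\<forall>\<^sub>F N in sequentially. \<forall>s\<in>cball 0 R.
      norm (eta_approx (Suc N) s - eta_approx N s) \<le> C * inverse ((real (Suc N))\<^sup>2)"
  proof eventually_elim
    case (elim N)
    show ?case
    proof
      fix s :: complex assume "s \<in> cball 0 R"
      then have "norm (s - 2) \<le> R + 2"
        using norm_triangle_ineq4[of s 2] by simp
      with elim show "norm (eta_approx (Suc N) s - eta_approx N s) \<le> C * inverse ((real (Suc N))\<^sup>2)"
        unfolding eta_approx_Suc_diff norm_divide norm_power norm_of_nat norm_mult norm_inverse divide_inverse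
        by (intro mult_right_mono) auto
    qed
  qed
  moreover have "summable (\<lambda>N. C * inverse ((real (Suc N))\<^sup>2))"
    using inverse_squares_sums[THEN sums_summable] by (intro summable_mult) (simp add: inverse_eq_divide)
  ultimately have "uniform_limit (cball 0 R) (\<lambda>n s. \<Sum>i<n. eta_approx (Suc i) s - eta_approx i s)
      (\<lambda>s. \<Sum>i. eta_approx (Suc i) s - eta_approx i s) sequentially"
    by (rule Weierstrass_m_test_ev)
  moreover have "(\<Sum>i<n. eta_approx (Suc i) s - eta_approx i s) = eta_approx n s" for n s
    by (subst sum_lessThan_telescope) (simp add: eta_approx_def)
  ultimately show ?thesis
    by (simp add: eta_limit_def[abs_def])
qed

lemma eta_limit_holomorphic: "eta_limit holomorphic_on UNIV"
proof (rule holomorphic_uniform_sequence[where f = eta_approx])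
  show "eta_approx N holomorphic_on UNIV" for N
    unfolding eta_approx_def[abs_def] by (intro holomorphic_intros)
  fix s :: complex
  have "uniform_limit (cball s 1) eta_approx eta_limit sequentially"
    by (rule uniform_limit_on_subset[OF uniform_limit_eta_approx_cball[of "norm s + 1"]])
       (use cball_subset_cball_iff[of s 1 0 "norm s + 1"] in \<open>simp add: dist_norm\<close>)
  then show "\<exists>d>0. cball s d \<subseteq> UNIV \<and> uniform_limit (cball s d) eta_approx eta_limit sequentially"
    by (intro exI[of _ 1]) auto
qed simp

section \<open>Identification of the limit with the eta function\<close>

lemma half_central_binomial_ratio_tendsto:
  "(\<lambda>N. real ((2 * N - 1) choose (N - m)) / real (2 * N choose N)) \<longlonglongrightarrow> 1 / 2"
proof (induction m)
  case 0
  have "real ((2 * N - 1) choose N) / real (2 * N choose N) = 1 / 2" if "N \<ge> 1" for N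
  proof -
    have "N * (2 * N choose N) = 2 * N * ((2 * N - 1) choose N)"
      using binomial_absorb_comp[of "2 * N" N] by simp
    then have "2 * N choose N = 2 * ((2 * N - 1) choose N)" using that by simp
    then show ?thesis by simp
  qed
  then have "\<forall>\<^sub>F N in sequentially. real ((2 * N - 1) choose (N - 0)) / real (2 * N choose N) = 1 / 2"
    by (intro eventually_mono[OF eventually_ge_at_top[of 1]]) simp
  then show ?case by (rule tendsto_eventually)
next
  case (Suc m)
  let ?v = "\<lambda>m N. real ((2 * N - 1) choose (N - m)) / real (2 * N choose N)"
  \<comment> \<open>Neighbouring coefficients of row \<open>2 * N - 1\<close> have the ratio
    \<open>(N - m) / (N + m)\<close>, which tends to 1; \<open>N > m\<close> keeps the natural
    subtractions exact.\<close>
  have "?v (Suc m) N = ?v m N * ((real N - real m) / (real N + real m))" if N: "N > m" for N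
  proof -
    define k where "k = N - Suc m"
    have "Suc k * ((2 * N - 1) choose Suc k) = (2 * N - 1 - k) * ((2 * N - 1) choose k)"
      using binomial_absorption[of k "2 * N - 1"] binomial_absorb_comp[of "2 * N - 1" k] by simp
    moreover have "Suc k = N - m" "2 * N - 1 - k = N + m" using N by (auto simp: k_def)
    ultimately have "real (N - m) * real ((2 * N - 1) choose (N - m)) =
        real (N + m) * real ((2 * N - 1) choose (N - Suc m))"
      unfolding k_def[symmetric] by (metis of_nat_mult)
    then have "real ((2 * N - 1) choose (N - Suc m)) =
        real ((2 * N - 1) choose (N - m)) * ((real N - real m) / (real N + real m))"
      using N by (simp add: field_simps of_nat_diff)
    then show ?thesis by simp
  qed
  then have "\<forall>\<^sub>F N in sequentially. ?v m N * ((real N - real m) / (real N + real m)) = ?v (Suc m) N"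
    by (intro eventually_mono[OF eventually_gt_at_top[of m]]) simp
  moreover have "(\<lambda>N. (real N - real m) / (real N + real m)) \<longlonglongrightarrow> 1"
    by real_asymp
  then have "(\<lambda>N. ?v m N * ((real N - real m) / (real N + real m))) \<longlonglongrightarrow> 1 / 2 * 1"
    by (intro tendsto_mult Suc.IH)
  ultimately show ?case
    by (simp add: filterlim_cong[OF refl refl] tendsto_cong)
qed

text \<open>For \<open>Re s > 0\<close> a single difference already gives absolutely summable terms.
  Its weights tend to \<open>1 / 2\<close>, so Tannery's theorem yields the limit
  \<open>suminf b\<close>. Partial sums of \<open>b\<close> and of the eta series differ by half a
  term of the latter, which tends to 0.\<close>

lemma eta_limit_sums:
  assumes "Re s > 0"
  shows "(\<lambda>n. (-1) ^ n * of_nat (Suc n) powr (- s)) sums eta_limit s"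
proof -
  define h :: "nat \<Rightarrow> complex" where "h m = of_nat m powr (- s)" for m
  define v where "v m N = real ((2 * N - 1) choose (N - m)) / real (2 * N choose N)" for m N
  define b where "b m = - ((-1) ^ m * of_real (1 / 2) * back_diff h m)" for m
  have "summable (\<lambda>m. norm (back_diff h m))"
  proof (rule summable_comparison_test_ev)
    have "norm (back_diff h m) \<le> norm s * real (m - 1) powr (- Re s - 1)" if "m \<ge> 2" for m
      using norm_power_diff_le[of s 1 "real m"] back_diff_eq_power_diff[of 1 m s] that assms
      by (simp add: h_def[abs_def] of_nat_diff)
    then show "\<forall>\<^sub>F m in sequentially. norm (norm (back_diff h m)) \<le> norm s * real (m - 1) powr (- Re s - 1)"
      by (intro eventually_mono[OF eventually_ge_at_top[of 2]]) simp
    have "summable (\<lambda>m. norm s * real m powr (- Re s - 1))"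
      using assms by (intro summable_mult) (simp add: summable_real_powr_iff)
    then show "summable (\<lambda>m. norm s * real (m - 1) powr (- Re s - 1))"
      by (subst summable_Suc_iff[symmetric]) simp
  qed
  have lim: "(\<lambda>N. eta_approx N s) \<longlonglongrightarrow> suminf b \<and> summable (\<lambda>m. norm (b m))"
  proof -
    \<comment> \<open>The cutoff matters: for \<open>m > N\<close> truncated subtraction makes the
      binomial coefficient 1 instead of 0.\<close>
    define a where "a m N = (if m \<le> N then - ((-1) ^ m * of_real (v m N) * back_diff h m) else 0)" for m N
    have "(a m \<longlongrightarrow> b m) sequentially" for m
    proof -
      have "(\<lambda>N. - ((-1) ^ m * of_real (v m N) * back_diff h m)) \<longlonglongrightarrow> b m"
        unfolding b_def v_def by (intro tendsto_intros half_central_binomial_ratio_tendsto)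
      then show ?thesis
        by (rule Lim_transform_eventually)
           (auto simp: a_def intro: eventually_mono[OF eventually_ge_at_top[of m]])
    qed
    moreover have "norm (a m N) \<le> norm (back_diff h m)" for m N
    proof -
      show ?thesis
        using norm_binomial_ratio_mult_le[of m N 1 "N - m" "back_diff h m"] by (simp add: a_def v_def)
    qed
    ultimately have "summable (\<lambda>m. norm (b m)) \<and> (\<lambda>N. \<Sum>m. a m N) \<longlonglongrightarrow> suminf b"
      using tannerys_theorem[of a b sequentially "\<lambda>m. norm (back_diff h m)"]
        \<open>summable (\<lambda>m. norm (back_diff h m))\<close> by (auto simp: case_prod_unfold)
    moreover have "(\<Sum>m. a m N) = eta_approx N s" if "N \<ge> 1" for N
    proof -
      have "(\<Sum>m. a m N) = (\<Sum>m\<le>N. a m N)"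
        by (rule suminf_finite) (auto simp: a_def)
      also have "\<dots> = eta_approx N s"
        using that by (subst eta_approx_back_diff[of 1]) (auto simp: a_def v_def h_def[abs_def] sum_negf)
      finally show ?thesis .
    qed
    then have "\<forall>\<^sub>F N in sequentially. (\<Sum>m. a m N) = eta_approx N s"
      by (intro eventually_mono[OF eventually_ge_at_top[of 1]]) simp
    ultimately show ?thesis
      by (simp add: tendsto_cong)
  qed
  have partial: "(\<Sum>j<n. (-1) ^ j * h (Suc j)) = (\<Sum>m<Suc n. b m) - (-1) ^ n * h n / 2" for n
  proof (induction n)
    case 0
    then show ?case by (simp add: b_def h_def)
  next
    case (Suc n)
    have "(\<Sum>j<Suc n. (-1) ^ j * h (Suc j)) = (\<Sum>m<Suc n. b m) - (-1) ^ n * h n / 2 + (-1) ^ n * h (Suc n)"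
      using Suc.IH by simp
    also have "\<dots> = (\<Sum>m<Suc (Suc n). b m) - (-1) ^ Suc n * h (Suc n) / 2"
      unfolding sum.lessThan_Suc[of _ "Suc n"] by (simp add: b_def field_simps del: sum.lessThan_Suc)
    finally show ?case .
  qed
  have "(\<lambda>n. (-1) ^ n * h n / 2) \<longlonglongrightarrow> 0"
  proof (rule tendsto_norm_zero_cancel)
    have "(\<lambda>n. real n powr (- Re s) / 2) \<longlonglongrightarrow> 0"
      using assms by real_asymp
    then show "(\<lambda>n. norm ((-1) ^ n * h n / 2)) \<longlonglongrightarrow> 0"
      by (simp add: norm_mult norm_power norm_divide h_def norm_powr_real_powr)
  qed
  moreover have "(\<lambda>n. \<Sum>m<Suc n. b m) \<longlonglongrightarrow> suminf b"
    using lim summable_LIMSEQ[of b] summable_norm_cancel LIMSEQ_Suc by blast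
  ultimately have "(\<lambda>n. \<Sum>j<n. (-1) ^ j * h (Suc j)) \<longlonglongrightarrow> suminf b"
    unfolding partial using tendsto_diff by fastforce
  moreover have "(\<lambda>N. eta_approx N s) \<longlonglongrightarrow> eta_limit s"
    by (rule tendsto_uniform_limitI[OF uniform_limit_eta_approx_cball[of "norm s"]]) simp
  then have "eta_limit s = suminf b"
    using lim LIMSEQ_unique by blast
  ultimately show ?thesis
    by (simp add: sums_def h_def)
qed

text \<open>\<open>eta_limit\<close> witnesses existence for the definite description; uniqueness is
  analytic continuation from the right half-plane.\<close>

lemma dirichlet_eta_eq_eta_limit: "dirichlet_eta = eta_limit"
  unfolding dirichlet_eta_def
proof (rule the_equality)
  show "eta_limit holomorphic_on UNIV \<and>
      (\<forall>s. Re s > 0 \<longrightarrow> (\<lambda>n. (-1) ^ n * of_nat (Suc n) powr (- s)) sums eta_limit s)"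
    using eta_limit_holomorphic eta_limit_sums by blast
  fix f :: "complex \<Rightarrow> complex"
  assume f: "f holomorphic_on UNIV \<and>
      (\<forall>s. Re s > 0 \<longrightarrow> (\<lambda>n. (-1) ^ n * of_nat (Suc n) powr (- s)) sums f s)"
  show "f = eta_limit"
  proof
    fix s
    show "f s = eta_limit s"
    proof (rule analytic_continuation_open[where f = f and g = eta_limit and s = "{s. Re s > 0}" and s' = UNIV])
      show "{s. Re s > 0} \<noteq> {}" by (auto intro: exI[of _ 1])
      show "f z = eta_limit z" if "z \<in> {s. Re s > 0}" for z
        using f eta_limit_sums[of z] that sums_unique2 by blast
    qed (use f eta_limit_holomorphic in \<open>auto simp: open_halfspace_Re_gt\<close>)
  qed
qed

lemma uniform_limit_eta_approx:
  assumes "compact K"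
  shows "uniform_limit K eta_approx dirichlet_eta sequentially"
proof -
  from compact_imp_bounded[OF assms] obtain R where "K \<subseteq> cball 0 R"
    unfolding bounded_iff by (auto simp: subset_iff)
  then show ?thesis
    unfolding dirichlet_eta_eq_eta_limit
    by (rule uniform_limit_on_subset[OF uniform_limit_eta_approx_cball])
qed

subsection \<open>The expectation as a determinant\<close>

text \<open>Keeping \<open>z\<close> as a factor avoids a division and so includes
  \<open>z = 0\<close>, a case that arises at negative even integers \<open>s\<close>.\<close>

lemma powr_integral_Ioo:
  fixes z :: complex
  assumes "0 < a" "a \<le> b"
  shows "z * (LINT x|lborel. indicator {a<..<b} x *\<^sub>R of_real x powr (z - 1)) = of_real b powr z - of_real a powr z"
proof -
  have deriv: "((\<lambda>x. of_real x powr z) has_vector_derivative z * of_real x powr (z - 1)) (at x within S)"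
    if "x > 0" for x S
    using that by (intro has_vector_derivative_real_field has_field_derivative_powr)
       (auto simp: complex_nonpos_Reals_iff)
  have "(LBINT x=a..b. z * of_real x powr (z - 1)) = of_real b powr z - of_real a powr z"
  proof (rule interval_integral_FTC_finite)
    show "continuous_on {min a b..max a b} (\<lambda>x. z * complex_of_real x powr (z - 1))"
      using assms by (intro continuous_intros) (auto simp: complex_nonpos_Reals_iff)
  qed (use assms in \<open>auto intro!: deriv\<close>)
  then show ?thesis
    using assms by (simp add: interval_integral_Ioo set_lebesgue_integral_def flip: integral_mult_right_zero)
qed

lemma powr_integrable_Ioo:
  fixes w :: complex
  assumes "0 < a"
  shows "integrable lborel (\<lambda>x. indicator {a<..<b} x *\<^sub>R of_real x powr w)"
proof -
  have "set_integrable lborel {a..b} (\<lambda>x. complex_of_real x powr w)"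
    using assms by (intro borel_integrable_atLeastAtMost' continuous_intros)
       (auto simp: complex_nonpos_Reals_iff)
  then have "set_integrable lborel {a<..<b} (\<lambda>x. complex_of_real x powr w)"
    by (rule set_integrable_subset) auto
  then show ?thesis by (simp add: set_integrable_def)
qed

lemma prod_pairs_shift:
  fixes f :: "nat \<Rightarrow> nat \<Rightarrow> 'a::comm_monoid_mult"
  shows "(\<Prod>j=1..n. \<Prod>i\<in>{1..<j}. f j i) = (\<Prod>j<n. \<Prod>i<j. f (Suc j) (Suc i))"
proof -
  have "(\<Prod>i\<in>{1..<Suc j}. f (Suc j) i) = (\<Prod>i<j. f (Suc j) (Suc i))" for j
    using prod.shift_bounds_Suc_ivl[of "f (Suc j)" 0 j] by (simp add: atLeast0LessThan)
  then show ?thesis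
    by (simp add: prod.atLeast1_atMost_eq)
qed

lemma interlacing_domain_pos:
  assumes "x \<in> interlacing_domain (Suc n)" "i \<in> {1..n}"
  shows "0 < x i"
  using assms by (force simp: interlacing_domain_def intro: less_trans[of 0 "(real i)\<^sup>2"])

text \<open>Interlacing puts the coordinates in increasing order. Nonnegativity is needed to pass
  from the \<open>ennreal\<close> density to a Bochner integral, as \<open>ennreal\<close> sends
  negative values to 0.\<close>

lemma dixon_anderson_density_nonneg: "0 \<le> dixon_anderson_density N x"
proof (cases "x \<in> interlacing_domain N")
  case True
  have "0 \<le> x j - x i" if "j \<in> {1..N - 1}" "i \<in> {1..<j}" for i j
  proof -
    have "x i < (real i + 1)\<^sup>2" "(real j)\<^sup>2 < x j"
      using True that by (auto simp: interlacing_domain_def)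
    moreover have "(real i + 1)\<^sup>2 \<le> (real j)\<^sup>2"
      using that by (intro power_mono) auto
    ultimately show ?thesis by linarith
  qed
  then show ?thesis
    unfolding dixon_anderson_density_def
    by (intro mult_nonneg_nonneg divide_nonneg_nonneg prod_nonneg ballI) (auto intro!: power_mono)
qed (simp add: dixon_anderson_density_def)

text \<open>The entry \<open>x ^ l\<close> of the Vandermonde matrix times
  \<open>x powr (s / 2)\<close>, cut off to one interval. The interlacing domain is a product of
  such intervals, so its indicator is distributed over the rows.\<close>

definition row_function :: "complex \<Rightarrow> nat \<Rightarrow> nat \<Rightarrow> real \<Rightarrow> complex" where
  "row_function s i l x = indicator {(real i)\<^sup>2<..<(real i + 1)\<^sup>2} x *\<^sub>R of_real x powr (of_nat l + s / 2)"

text \<open>The power with exponent \<open>l + 1 + s / 2\<close>, which comes from integrating a row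
  function, evaluated at the node \<open>(i + 1)^2\<close>; nodes count from 0 here.\<close>

definition node_power :: "complex \<Rightarrow> nat \<Rightarrow> nat \<Rightarrow> complex" where
  "node_power s i l = of_nat (Suc i) powr (2 * of_nat (Suc l) + s)"

lemma square_powr_half:
  assumes "0 < t"
  shows "complex_of_real (t\<^sup>2) powr z = of_real t powr (2 * z)"
proof -
  have "Ln (complex_of_real (t\<^sup>2)) = 2 * Ln (complex_of_real t)"
    using assms by (simp only: Ln_of_real zero_less_power ln_realpow) simp
  then show ?thesis
    by (simp only: powr_def) (use assms in \<open>simp add: mult_ac\<close>)
qed

lemma row_function_integral:
  "(of_nat (Suc l) + s / 2) * integral\<^sup>L lborel (row_function s (Suc i) l) = node_power s (Suc i) l - node_power s i l"
proof -
  define z where "z = of_nat (Suc l) + s / 2"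
  have z: "of_nat l + s / 2 = z - 1" "2 * of_nat (Suc l) + s = 2 * z"
    by (simp_all add: z_def algebra_simps)
  have "(real (Suc i))\<^sup>2 \<le> (real (Suc i) + 1)\<^sup>2"
    by (intro power_mono) auto
  then have "z * integral\<^sup>L lborel (row_function s (Suc i) l) =
      of_real ((real (Suc i) + 1)\<^sup>2) powr z - of_real ((real (Suc i))\<^sup>2) powr z"
    unfolding row_function_def[abs_def] z by (intro powr_integral_Ioo) auto
  also have "\<dots> = node_power s (Suc i) l - node_power s i l"
    unfolding node_power_def z
    by (subst (1 2) square_powr_half) (auto simp: add.commute)
  finally show ?thesis by (simp only: z_def)
qed

text \<open>The Leibniz expansion of the Vandermonde product writes the integrand as a sum of
  products of functions of one coordinate each, ready for Fubini. Coordinates count from 1 but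
  permutations act on \<open>{0..<n}\<close>, hence \<open>p (i - 1)\<close>.\<close>

lemma density_times_product:
  fixes s :: complex and n :: nat
  defines "c \<equiv> \<Prod>i=1..n. complex_of_real (real i * (real i + 1)) powr (- s / 2)"
  defines "V \<equiv> \<Prod>j=1..Suc n. \<Prod>i\<in>{1..<j}. (real j)\<^sup>2 - (real i)\<^sup>2"
  shows "dixon_anderson_density (Suc n) x *\<^sub>R
      (\<Prod>i=1..n. complex_of_real (x i / (real i * (real i + 1))) powr (s / 2)) =
    fact n / of_real V * c * (\<Sum>p | p permutes {0..<n}. signof p *
      (\<Prod>i=1..n. row_function s i (p (i - 1)) (x i)))"
proof (cases "x \<in> interlacing_domain (Suc n)")
  case False
  then obtain k where k: "k \<in> {1..n}" "\<not> ((real k)\<^sup>2 < x k \<and> x k < (real k + 1)\<^sup>2)"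
    by (auto simp: interlacing_domain_def)
  \<comment> \<open>One coordinate outside its interval makes every product on the right vanish, as
    the density does on the left.\<close>
  then have zero: "(\<Prod>i=1..n. row_function s i (p (i - 1)) (x i)) = 0" for p
    by (intro prod_zero) (auto simp: row_function_def indicator_def)
  show ?thesis
    unfolding zero using False by (simp add: dixon_anderson_density_def)
next
  case True
  have "of_real (x i / (real i * (real i + 1))) powr (s / 2) =
      complex_of_real (real i * (real i + 1)) powr (- s / 2) * of_real (x i) powr (s / 2)"
    if "i \<in> {1..n}" for i
  proof -
    have "0 < x i" by (rule interlacing_domain_pos[OF True that])
    moreover have "0 < real i * (real i + 1)" using that by simp
    ultimately show ?thesis
      by (simp only: powr_def of_real_eq_0_iff Ln_of_real ln_div divide_pos_pos of_real_diff if_False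
            less_imp_neq[symmetric] exp_add[symmetric] ) (simp add: algebra_simps ln_div)
  qed
  then have prod: "(\<Prod>i=1..n. complex_of_real (x i / (real i * (real i + 1))) powr (s / 2)) =
      c * (\<Prod>i=1..n. of_real (x i) powr (s / 2))"
    unfolding c_def prod.distrib[symmetric] by (intro prod.cong) auto
  have "complex_of_real (\<Prod>j=1..n. \<Prod>i\<in>{1..<j}. x j - x i) =
      (\<Prod>j<n. \<Prod>i<j. complex_of_real (x (Suc j)) - complex_of_real (x (Suc i)))"
    by (subst prod_pairs_shift) simp
  also have "\<dots> = det (mat n n (\<lambda>(i, l). complex_of_real (x (Suc i)) ^ l))"
    by (rule det_vandermonde[symmetric])
  also have "\<dots> = (\<Sum>p | p permutes {0..<n}. signof p * (\<Prod>i=0..<n. of_real (x (Suc i)) ^ p i))"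
    unfolding det_def'[OF mat_carrier]
    by (intro sum.cong refl) (auto simp: permutes_in_image intro!: prod.cong)
  also have "\<dots> = (\<Sum>p | p permutes {0..<n}. signof p * (\<Prod>i=1..n. of_real (x i) ^ p (i - 1)))"
    by (simp add: prod.atLeast1_atMost_eq atLeast0LessThan)
  finally have vand: "complex_of_real (\<Prod>j=1..n. \<Prod>i\<in>{1..<j}. x j - x i) = \<dots>" .
  have row: "row_function s i l (x i) = of_real (x i) ^ l * of_real (x i) powr (s / 2)" if "i \<in> {1..n}" for i l
  proof -
    have "(real i)\<^sup>2 < x i \<and> x i < (real i + 1)\<^sup>2"
      using True that by (auto simp: interlacing_domain_def)
    moreover have "0 < x i" by (rule interlacing_domain_pos[OF True that])
    ultimately show ?thesis
      by (simp add: row_function_def powr_add)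
  qed
  have "(\<Sum>p | p permutes {0..<n}. signof p * (\<Prod>i=1..n. row_function s i (p (i - 1)) (x i))) =
      (\<Sum>p | p permutes {0..<n}. signof p * (\<Prod>i=1..n. of_real (x i) ^ p (i - 1))) *
      (\<Prod>i=1..n. of_real (x i) powr (s / 2))"
    by (simp add: row prod.distrib sum_distrib_right mult.assoc)
  then show ?thesis
    using True unfolding prod vand[symmetric]
    by (simp add: dixon_anderson_density_def V_def scaleR_conv_of_real)
qed

text \<open>The law of the vector turns the expectation into a Lebesgue integral over a finite
  product space, and Fubini factors the term of each permutation.\<close>

lemma expectation_dixon_anderson:
  fixes M :: "'a measure" and X :: "nat \<Rightarrow> 'a \<Rightarrow> real" and s :: complex
  assumes X: "distributed M (\<Pi>\<^sub>M i\<in>{1..n}. lborel) (\<lambda>\<omega>. \<lambda>i\<in>{1..n}. X i \<omega>)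
    (\<lambda>x. ennreal (dixon_anderson_density (Suc n) x))"
  shows "(\<integral>\<omega>. (\<Prod>i=1..n. complex_of_real (X i \<omega> / (real i * (real i + 1))) powr (s / 2)) \<partial>M) =
    fact n / of_real (\<Prod>j=1..Suc n. \<Prod>i\<in>{1..<j}. (real j)\<^sup>2 - (real i)\<^sup>2) *
    (\<Prod>i=1..n. complex_of_real (real i * (real i + 1)) powr (- s / 2)) *
    (\<Sum>p | p permutes {0..<n}. signof p * (\<Prod>i=1..n. integral\<^sup>L lborel (row_function s i (p (i - 1)))))"
proof -
  interpret product_sigma_finite "\<lambda>_::nat. lborel :: real measure" ..
  let ?L = "\<Pi>\<^sub>M i\<in>{1..n}. (lborel :: real measure)"
  define g where "g x = (\<Prod>i=1..n. complex_of_real (x i / (real i * (real i + 1))) powr (s / 2))" for x :: "nat \<Rightarrow> real"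
  have g_meas: "g \<in> borel_measurable ?L"
    unfolding g_def[abs_def] powr_def by measurable
  have d_meas: "dixon_anderson_density (Suc n) \<in> borel_measurable ?L"
    using X by (intro distributed_real_measurable dixon_anderson_density_nonneg)
  have int: "integrable lborel (row_function s i l)" if "i \<in> {1..n}" for i l
    unfolding row_function_def[abs_def] using that by (intro powr_integrable_Ioo) auto
  have "(\<integral>\<omega>. (\<Prod>i=1..n. complex_of_real (X i \<omega> / (real i * (real i + 1))) powr (s / 2)) \<partial>M) =
      (\<integral>\<omega>. g (\<lambda>i\<in>{1..n}. X i \<omega>) \<partial>M)"
    by (simp add: g_def)
  also have "\<dots> = integral\<^sup>L (distr M ?L (\<lambda>\<omega>. \<lambda>i\<in>{1..n}. X i \<omega>)) g"
    using distributed_measurable[OF X] g_meas by (rule integral_distr[symmetric])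
  also have "\<dots> = (\<integral>x. dixon_anderson_density (Suc n) x *\<^sub>R g x \<partial>?L)"
    unfolding distributed_distr_eq_density[OF X]
    using g_meas d_meas by (intro integral_density) (auto simp: dixon_anderson_density_nonneg)
  also have "\<dots> = fact n / of_real (\<Prod>j=1..Suc n. \<Prod>i\<in>{1..<j}. (real j)\<^sup>2 - (real i)\<^sup>2) *
      (\<Prod>i=1..n. complex_of_real (real i * (real i + 1)) powr (- s / 2)) *
      (\<integral>x. (\<Sum>p | p permutes {0..<n}. signof p * (\<Prod>i=1..n. row_function s i (p (i - 1)) (x i))) \<partial>?L)"
    unfolding g_def density_times_product by (rule integral_mult_right_zero)
  also have "(\<integral>x. (\<Sum>p | p permutes {0..<n}. signof p * (\<Prod>i=1..n. row_function s i (p (i - 1)) (x i))) \<partial>?L) =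
      (\<Sum>p | p permutes {0..<n}. signof p * (\<Prod>i=1..n. integral\<^sup>L lborel (row_function s i (p (i - 1)))))"
  proof (subst Bochner_Integration.integral_sum)
    fix p :: "nat \<Rightarrow> nat"
    have "integrable ?L (\<lambda>x. \<Prod>i=1..n. row_function s i (p (i - 1)) (x i))"
      by (intro product_integrable_prod int) auto
    then show "integrable ?L (\<lambda>x. signof p * (\<Prod>i=1..n. row_function s i (p (i - 1)) (x i)))"
      by simp
  next
    have "(\<integral>x. (\<Prod>i=1..n. row_function s i (p (i - 1)) (x i)) \<partial>?L) =
        (\<Prod>i=1..n. integral\<^sup>L lborel (row_function s i (p (i - 1))))" for p
      by (intro product_integral_prod int) auto
    then show "(\<Sum>p | p permutes {0..<n}. \<integral>x. signof p * (\<Prod>i=1..n. row_function s i (p (i - 1)) (x i)) \<partial>?L) =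
        (\<Sum>p | p permutes {0..<n}. signof p * (\<Prod>i=1..n. integral\<^sup>L lborel (row_function s i (p (i - 1)))))"
      by simp
  qed
  finally show ?thesis .
qed

section \<open>Evaluation of the minors and final cancellation\<close>

lemma det_node_power_minor:
  assumes "j \<le> n"
  defines "sk \<equiv> \<lambda>i. if i < j then i else Suc i"
  shows "det (mat n n (\<lambda>(i, l). node_power s (sk i) l)) =
    (\<Prod>i<n. of_nat (Suc (sk i)) powr (2 + s)) *
    of_real (\<Prod>i<n. \<Prod>m<i. (real (sk i) + 1)\<^sup>2 - (real (sk m) + 1)\<^sup>2)"
proof -
  \<comment> \<open>The first factor is common to the row, and what remains are powers of the
    squared node: each minor is a Vandermonde determinant with scaled rows.\<close>
  have "node_power s i l = of_nat (Suc i) powr (2 + s) * (complex_of_real ((real i + 1)\<^sup>2)) ^ l" for i l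
  proof -
    have "node_power s i l = of_nat (Suc i) powr (2 + s) * of_nat (Suc i) powr (of_nat (2 * l))"
      unfolding node_power_def powr_add[symmetric] by (simp add: algebra_simps)
    also have "complex_of_nat (Suc i) powr (of_nat (2 * l)) = of_nat (Suc i) ^ (2 * l)"
      by (rule powr_complexpow) (simp del: of_nat_Suc)
    also have "complex_of_nat (Suc i) ^ (2 * l) = (complex_of_real ((real i + 1)\<^sup>2)) ^ l"
      by (simp add: power_mult add.commute)
    finally show ?thesis .
  qed
  then show ?thesis
    by (simp only: det_scale_rows det_vandermonde) simp
qed

lemma prod_skip_node:
  fixes f :: "nat \<Rightarrow> 'a::comm_monoid_mult"
  assumes "j \<le> n"
  shows "(\<Prod>i<n. f (if i < j then i else Suc i)) * f j = (\<Prod>i<Suc n. f i)"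
proof -
  have "(\<Prod>i<n. f (if i < j then i else Suc i)) = (\<Prod>i\<in>{..<Suc n} - {j}. f i)"
    using assms
    by (intro prod.reindex_bij_witness[of _ "\<lambda>m. if m < j then m else m - 1"
          "\<lambda>m. if m < j then m else Suc m"]) (auto split: if_splits)
  then show ?thesis
    using assms by (subst prod.remove[of _ j]) (auto simp: mult.commute)
qed

text \<open>The row factors combine with the prefactor to \<open>(fact (Suc n))^2\<close>, up to the
  deleted node. The Vandermonde products cancel down to the differences at that node, which
  \<open>prod_square_differences\<close> evaluates. The remaining 2 cancels the \<open>1 / 2\<close>
  in \<open>inverse_s_Gamma\<close>.\<close>

lemma minor_ratio:
  fixes s :: complex and n j :: nat
  assumes "j \<le> n"
  defines "sk \<equiv> \<lambda>i. if i < j then i else Suc i"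
  defines "V \<equiv> \<Prod>i<Suc n. \<Prod>m<i. (real i + 1)\<^sup>2 - (real m + 1)\<^sup>2"
  shows "(\<Prod>i<Suc n. of_nat (Suc i) powr (- s)) * det (mat n n (\<lambda>(i, l). node_power s (sk i) l)) / of_real V =
    2 * of_real (real (2 * Suc n choose (Suc n - Suc j)) / real (2 * Suc n choose Suc n)) * of_nat (Suc j) powr (- s)"
proof -
  define P where "P = (\<Prod>m<j. (real j + 1)\<^sup>2 - (real m + 1)\<^sup>2) * (\<Prod>i\<in>{j<..n}. (real i + 1)\<^sup>2 - (real j + 1)\<^sup>2)"
  define W where "W = (\<Prod>i<n. \<Prod>m<i. (real (sk i) + 1)\<^sup>2 - (real (sk m) + 1)\<^sup>2)"
  define D where "D = (\<Prod>i<n. of_nat (Suc (sk i)) powr (2 + s) :: complex)"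
  have VW: "V = W * P"
    unfolding V_def W_def P_def sk_def
    using vandermonde_remove_node[OF assms(1), of "\<lambda>i. (real i + 1)\<^sup>2"] by simp
  have P: "P * (2 * (real j + 1)\<^sup>2) = fact (n - j) * fact (n + j + 2)"
    unfolding P_def using prod_square_differences[OF assms(1)] by simp
  have "V \<noteq> 0"
  proof -
    have "(real i + 1)\<^sup>2 - (real m + 1)\<^sup>2 \<noteq> 0" if "m < i" for i m
      using that power_strict_mono[of "real m + 1" "real i + 1" 2] by simp
    then show ?thesis by (auto simp: V_def simp del: prod.lessThan_Suc)
  qed
  then have "W \<noteq> 0" "P \<noteq> 0" using VW by auto
  have 1: "D * of_nat (Suc j) powr (2 + s) = (\<Prod>i<Suc n. of_nat (Suc i) powr (2 + s))"
    unfolding D_def sk_def using prod_skip_node[OF assms(1), of "\<lambda>i. of_nat (Suc i) powr (2 + s)"] by simp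
  have 2: "(\<Prod>i<Suc n. of_nat (Suc i) powr (- s)) * (\<Prod>i<Suc n. of_nat (Suc i) powr (2 + s)) =
      (fact (Suc n) :: complex)\<^sup>2"
  proof -
    have "of_nat (Suc i) powr (- s) * of_nat (Suc i) powr (2 + s) = (complex_of_nat (Suc i))\<^sup>2" for i
      by (simp flip: powr_add del: of_nat_Suc)
    then have "(\<Prod>i<Suc n. of_nat (Suc i) powr (- s)) * (\<Prod>i<Suc n. of_nat (Suc i) powr (2 + s)) =
        (\<Prod>i<Suc n. (complex_of_nat (Suc i))\<^sup>2)"
      unfolding prod.distrib[symmetric] by (intro prod.cong) auto
    also have "\<dots> = (fact (Suc n))\<^sup>2"
      unfolding fact_prod_Suc atLeast0LessThan of_nat_prod by (rule prod_power_distrib[symmetric])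
    finally show ?thesis .
  qed
  have 3: "of_nat (Suc j) powr (- s) * of_nat (Suc j) powr (2 + s) = (of_nat (Suc j) :: complex)\<^sup>2"
    by (simp flip: powr_add del: of_nat_Suc)
  have "(\<Prod>i<Suc n. of_nat (Suc i) powr (- s)) * D * (of_nat (Suc j))\<^sup>2 =
      (fact (Suc n))\<^sup>2 * of_nat (Suc j) powr (- s)"
    unfolding 2[symmetric] 3[symmetric] 1[symmetric] by (simp only: mult_ac)
  then have D: "(\<Prod>i<Suc n. of_nat (Suc i) powr (- s)) * D =
      (fact (Suc n))\<^sup>2 * of_nat (Suc j) powr (- s) / (of_nat (Suc j))\<^sup>2"
    by (simp add: eq_divide_eq del: of_nat_Suc fact_Suc prod.lessThan_Suc)
  have "det (mat n n (\<lambda>(i, l). node_power s (sk i) l)) = D * of_real W"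
    unfolding D_def W_def sk_def by (rule det_node_power_minor[OF assms(1)])
  then have "(\<Prod>i<Suc n. of_nat (Suc i) powr (- s)) * det (mat n n (\<lambda>(i, l). node_power s (sk i) l)) / of_real V =
      ((\<Prod>i<Suc n. of_nat (Suc i) powr (- s)) * D) / of_real P"
    using \<open>W \<noteq> 0\<close> VW by simp
  also have "\<dots> = of_real (2 * (fact (Suc n))\<^sup>2 / (P * (2 * (real j + 1)\<^sup>2))) * of_nat (Suc j) powr (- s)"
    unfolding D using \<open>P \<noteq> 0\<close> by (simp add: field_simps del: fact_Suc)
  also have "2 * (fact (Suc n))\<^sup>2 / (P * (2 * (real j + 1)\<^sup>2)) =
      2 * (real (2 * Suc n choose (Suc n - Suc j)) / real (2 * Suc n choose Suc n))"
    unfolding P using central_binomial_ratio[of "Suc j" "Suc n"] assms(1) by simp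
  finally show ?thesis by simp
qed

lemma scaled_expectation_eq_eta_approx:
  fixes M :: "'a measure" and X :: "nat \<Rightarrow> 'a \<Rightarrow> real" and s :: complex
  assumes X: "distributed M (\<Pi>\<^sub>M i\<in>{1..n}. lborel) (\<lambda>\<omega>. \<lambda>i\<in>{1..n}. X i \<omega>)
    (\<lambda>x. ennreal (dixon_anderson_density (Suc n) x))"
  shows "inverse_s_Gamma (Suc n) s *
      (\<integral>\<omega>. (\<Prod>i=1..n. complex_of_real (X i \<omega> / (real i * (real i + 1))) powr (s / 2)) \<partial>M) =
    eta_approx (Suc n) s"
proof -
  define V where "V = (\<Prod>i<Suc n. \<Prod>m<i. (real i + 1)\<^sup>2 - (real m + 1)\<^sup>2)"
  define I where "I i l = integral\<^sup>L lborel (row_function s i l)" for i l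
  define c where "c = (\<Prod>i=1..n. complex_of_real (real i * (real i + 1)) powr (- s / 2))"
  define c' where "c' = (\<Prod>i=1..n. (1 + 1 / complex_of_nat i) powr (- s / 2))"
  have V: "(\<Prod>j=1..Suc n. \<Prod>i\<in>{1..<j}. (real j)\<^sup>2 - (real i)\<^sup>2) = V"
    unfolding prod_pairs_shift V_def by (simp add: add.commute)
  \<comment> \<open>The bases multiply to \<open>(1 + 1 / i) * i * (i + 1) = (i + 1)^2\<close>, so
    the two normalising products merge into one.\<close>
  have cc: "c' * c = (\<Prod>i<Suc n. of_nat (Suc i) powr (- s))"
  proof -
    have "(1 + 1 / complex_of_nat i) powr (- s / 2) * complex_of_real (real i * (real i + 1)) powr (- s / 2) =
        of_nat (Suc i) powr (- s)" if "i \<in> {1..n}" for i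
    proof -
      have i: "real i > 0" using that by simp
      have "(1 + 1 / complex_of_nat i) powr (- s / 2) * complex_of_real (real i * (real i + 1)) powr (- s / 2) =
          (complex_of_real (1 + 1 / real i) * complex_of_real (real i * (real i + 1))) powr (- s / 2)"
        using i by (subst powr_times_real) (auto intro!: add_nonneg_nonneg)
      also have "complex_of_real (1 + 1 / real i) * complex_of_real (real i * (real i + 1)) =
          complex_of_real ((real (Suc i))\<^sup>2)"
        using i unfolding of_real_mult[symmetric] of_real_eq_iff by (simp add: field_simps power2_eq_square)
      also have "\<dots> powr (- s / 2) = of_nat (Suc i) powr (- s)"
        using square_powr_half[of "real (Suc i)" "- s / 2"] by simp
      finally show ?thesis .
    qed
    then have "c' * c = (\<Prod>i=1..n. of_nat (Suc i) powr (- s))"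
      unfolding c_def c'_def prod.distrib[symmetric] by (intro prod.cong) auto
    also have "\<dots> = (\<Prod>i<Suc n. of_nat (Suc i) powr (- s))"
      unfolding prod.lessThan_Suc_shift by (simp add: prod.atLeast1_atMost_eq)
    finally show ?thesis .
  qed
  \<comment> \<open>The \<open>fact n\<close> of the density clears the denominators and leaves
    exactly the factors that the integrals of the row functions call for.\<close>
  have scaled: "fact n * (\<Prod>i=1..n. 1 + s / (2 * of_nat i)) = (\<Prod>i=0..<n. of_nat (Suc i) + s / 2)"
  proof -
    have "fact n = (\<Prod>i=1..n. complex_of_nat i)"
      by (simp add: fact_prod)
    then have "fact n * (\<Prod>i=1..n. 1 + s / (2 * of_nat i)) = (\<Prod>i=1..n. of_nat i * (1 + s / (2 * of_nat i)))"
      by (simp add: prod.distrib)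
    also have "\<dots> = (\<Prod>i=1..n. of_nat i + s / 2)"
      by (intro prod.cong) (auto simp: field_simps)
    finally show ?thesis by (simp add: prod.atLeast1_atMost_eq atLeast0LessThan)
  qed
  have row: "fact n * (\<Prod>i=1..n. 1 + s / (2 * of_nat i)) * (\<Prod>i=1..n. I i (p (i - 1))) =
      (\<Prod>i=0..<n. node_power s (Suc i) (p i) - node_power s i (p i))" if p: "p permutes {0..<n}" for p
  proof -
    \<comment> \<open>The factor required by an integral depends only on its column. Reindexing by
      \<open>p\<close> gives each row the factor of the column chosen there, so the same scalar
      serves every permutation.\<close>
    have "(\<Prod>i=0..<n. of_nat (Suc i) + s / 2) = (\<Prod>i=0..<n. of_nat (Suc (p i)) + s / 2)"
      by (rule prod.permute[OF p, unfolded o_def])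
    then have "fact n * (\<Prod>i=1..n. 1 + s / (2 * of_nat i)) * (\<Prod>i=1..n. I i (p (i - 1))) =
        (\<Prod>i=0..<n. (of_nat (Suc (p i)) + s / 2) * I (Suc i) (p i))"
      unfolding scaled by (simp add: prod.distrib prod.atLeast1_atMost_eq atLeast0LessThan)
    then show ?thesis
      unfolding I_def row_function_integral .
  qed
  have "fact n * (\<Prod>i=1..n. 1 + s / (2 * of_nat i)) *
        (\<Sum>p | p permutes {0..<n}. signof p * (\<Prod>i=1..n. I i (p (i - 1)))) =
      (\<Sum>p | p permutes {0..<n}. signof p *
        (\<Prod>i=0..<n. node_power s (Suc i) (p i) - node_power s i (p i)))"
    unfolding sum_distrib_left by (intro sum.cong refl) (simp add: mult_ac flip: row)
  also have "\<dots> = det (mat n n (\<lambda>(i, l). node_power s (Suc i) l - node_power s i l))"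
    unfolding det_def'[OF mat_carrier]
    by (intro sum.cong refl arg_cong2[of _ _ _ _ "(*)"] prod.cong) (auto simp: permutes_in_image)
  also have "\<dots> = (\<Sum>j\<le>n. (-1) ^ j * det (mat n n (\<lambda>(i, l). node_power s (if i < j then i else Suc i) l)))"
    by (rule det_row_differences)
  finally have det: "fact n * (\<Prod>i=1..n. 1 + s / (2 * of_nat i)) *
      (\<Sum>p | p permutes {0..<n}. signof p * (\<Prod>i=1..n. I i (p (i - 1)))) = \<dots>" .
  define C where "C = (\<Prod>i<Suc n. complex_of_nat (Suc i) powr (- s))"
  define m where "m j = det (mat n n (\<lambda>(i, l). node_power s (if i < j then i else Suc i) l))" for j
  define w where "w j = complex_of_real (real (2 * Suc n choose (Suc n - Suc j)) / real (2 * Suc n choose Suc n))" for j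
  have minor: "C * m j / of_real V = 2 * w j * of_nat (Suc j) powr (- s)" if "j \<le> n" for j
    unfolding C_def m_def w_def V_def by (rule minor_ratio[OF that])
  have term_eq: "1 / 2 * C / of_real V * ((-1) ^ j * m j) = (-1) ^ j * w j * of_nat (Suc j) powr (- s)"
    if "j \<le> n" for j
  proof -
    have "1 / 2 * C / of_real V * ((-1) ^ j * m j) = 1 / 2 * (-1) ^ j * (C * m j / of_real V)"
      by simp
    then show ?thesis
      unfolding minor[OF that] by (simp del: of_nat_Suc)
  qed
  have "inverse_s_Gamma (Suc n) s *
      (\<integral>\<omega>. (\<Prod>i=1..n. complex_of_real (X i \<omega> / (real i * (real i + 1))) powr (s / 2)) \<partial>M) =
    1 / 2 * (c' * c) / of_real V * (fact n * (\<Prod>i=1..n. 1 + s / (2 * of_nat i)) *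
      (\<Sum>p | p permutes {0..<n}. signof p * (\<Prod>i=1..n. I i (p (i - 1)))))"
    unfolding expectation_dixon_anderson[OF X] V I_def[symmetric] c_def[symmetric]
    by (simp add: inverse_s_Gamma_def prod.distrib c'_def)
  also have "\<dots> = 1 / 2 * C / of_real V * (\<Sum>j\<le>n. (-1) ^ j * m j)"
    unfolding det cc C_def m_def ..
  also have "\<dots> = (\<Sum>j\<le>n. 1 / 2 * C / of_real V * ((-1) ^ j * m j))"
    by (rule sum_distrib_left)
  also have "\<dots> = (\<Sum>j<Suc n. (-1) ^ j * w j * of_nat (Suc j) powr (- s))"
    unfolding lessThan_Suc_atMost by (intro sum.cong refl term_eq) simp
  also have "\<dots> = eta_approx (Suc n) s"
    unfolding eta_approx_def w_def ..
  finally show ?thesis .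
qed

theorem theorem3:
  fixes M :: "nat \<Rightarrow> 'a measure"
    and X :: "nat \<Rightarrow> nat \<Rightarrow> 'a \<Rightarrow> real"
    and K :: "complex set"
  assumes "\<And>N. N \<ge> 2 \<Longrightarrow> prob_space (M N)"
    and "\<And>N. N \<ge> 2 \<Longrightarrow>
           distributed (M N) (\<Pi>\<^sub>M n\<in>{1..N-1}. lborel) (\<lambda>\<omega>. \<lambda>n\<in>{1..N-1}. X N n \<omega>)
             (\<lambda>x. ennreal (dixon_anderson_density N x))"
    and "compact K"
  shows "uniform_limit K
           (\<lambda>N s. inverse_s_Gamma N s *
              prob_space.expectation (M N)
                (\<lambda>\<omega>. \<Prod>n=1..N-1.
                   complex_of_real (X N n \<omega> / (real n * (real n + 1))) powr (s / 2)))
           dirichlet_eta sequentially"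
proof -
  have "inverse_s_Gamma N s * prob_space.expectation (M N)
      (\<lambda>\<omega>. \<Prod>n=1..N-1. complex_of_real (X N n \<omega> / (real n * (real n + 1))) powr (s / 2)) = eta_approx N s"
    if "N \<ge> 2" for N s
  proof -
    from that obtain n where "N = Suc n" by (cases N) auto
    then show ?thesis
      using scaled_expectation_eq_eta_approx[of "M N" n "X N" s] assms(2)[OF that] by simp
  qed
  then have "\<forall>\<^sub>F N in sequentially. \<forall>s\<in>K. inverse_s_Gamma N s * prob_space.expectation (M N)
      (\<lambda>\<omega>. \<Prod>n=1..N-1. complex_of_real (X N n \<omega> / (real n * (real n + 1))) powr (s / 2)) = eta_approx N s"
    by (intro eventually_mono[OF eventually_ge_at_top[of 2]]) simp
  from uniform_limit_cong[OF this refl] show ?thesis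
    using uniform_limit_eta_approx[OF assms(3)] by blast
qed

end
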